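(* Let $q$ be a prime power and let $k\ge 2$ and $2k-1\le n\le q$ be integers. Fix an $[n,k]_q$ Reed--Solomon code $C$. The number of $[n,k]_q$ Reed--Solomon codes $D$ with $\dim(C\cap D)\ge 2$, including $D=C$, is at most $$B_q(k,n):=2(k-1)^{n-2}q^{2k-4}.$$
   Context: An $[n,k]_q$ Reed--Solomon code is a subspace of $\mathbb{F}_q^n$ of the form $\mathsf{RS}_{n,k}(\underline{\alpha})=\{(f(\alpha_1),\ldots,f(\alpha_n)) : f\in\mathbb{F}_q[x],\ \deg f<k\}$, where $\underline{\alpha}=(\alpha_1,\ldots,\alpha_n)\in\mathbb{F}_q^n$ has pairwise distinct entries. Codes are counted as distinct subspaces of $\mathbb{F}_q^n$. *)

theory Defs
  imports "HOL-Analysis.Cartesian_Space" "HOL-Computational_Algebra.Polynomial"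
begin

text \<open>
  The space of words of length \<open>n\<close> over the field with \<open>q\<close> elements is the type
  \<open>'a ^ 'n\<close>, with \<open>q = CARD('a)\<close> and \<open>n = CARD('n)\<close>. The zero polynomial has \<open>degree\<close> 0,
  so for \<open>k \<ge> 1\<close> the condition \<open>degree f < k\<close> includes it, as it should.
\<close>

definition RS :: "nat \<Rightarrow> 'a::field ^ 'n \<Rightarrow> ('a ^ 'n) set" where
  "RS k \<alpha> = {\<chi> i. poly f (\<alpha> $ i) | f. degree f < k}"

text \<open>Codes are sets of words, so evaluation vectors with the same code are not counted twice.\<close>

definition RS_codes :: "nat \<Rightarrow> ('a::field ^ 'n) set set" where
  "RS_codes k = {RS k \<alpha> | \<alpha>. inj (\<lambda>i. \<alpha> $ i)}"

definition B :: "nat \<Rightarrow> nat \<Rightarrow> nat \<Rightarrow> nat" where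
  "B q k n = 2 * (k - 1) ^ (n - 2) * q ^ (2 * k - 4)"

end

theory Submission
  imports Defs
begin

text \<open>
  Every code contains the constant words, so \<open>dim (C \<inter> D) \<ge> 2\<close> forces a nonconstant common
  word \<open>f(\<alpha>) = g(\<beta>)\<close>. The code \<open>D\<close> does not change when its evaluation vector \<open>\<beta>\<close> undergoes an
  invertible affine map (\<open>RS_affine\<close>), and this freedom is spent on fixing two coordinates,
  \<open>\<beta>\<^sub>0 = 0\<close> and \<open>\<beta>\<^sub>1 = 1\<close>. Given \<open>f\<close> and \<open>g\<close>, each of the other \<open>n - 2\<close> coordinates \<open>\<beta>\<^sub>i\<close> is a root of
  \<open>g - f(\<alpha>\<^sub>i)\<close> and so takes at most \<open>k - 1\<close> values (\<open>card_fibres\<close>).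

  It remains to count the pairs \<open>(f, g)\<close>. Subtracting a constant from the common word makes
  \<open>f(\<alpha>\<^sub>0) = 0\<close>, which leaves \<open>q\<^bsup>k-1\<^esup>\<close> choices of \<open>f\<close>; then \<open>g\<close> has prescribed values at the two points
  \<open>0\<close> and \<open>1\<close>, which leaves \<open>q\<^bsup>k-2\<^esup>\<close> choices (\<open>card_poly_prescribed\<close>). Finally \<open>(f, g)\<close> may be scaled
  by any of the \<open>q - 1\<close> nonzero constants, so each \<open>D\<close> is counted at least \<open>q - 1\<close> times, and
  \<open>(q - 1) N \<le> q\<^bsup>2k-3\<^esup> (k - 1)\<^bsup>n-2\<^esup>\<close> for the number \<open>N\<close> of codes \<open>D\<close>. The factor 2 in the bound
  comes from \<open>q \<le> 2 (q - 1)\<close>.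
\<close>

lemma RS_affine:
  fixes \<alpha> :: "'a::field ^ 'n"
  assumes "a \<noteq> 0"
  shows "RS k (\<chi> i. a * \<alpha> $ i + b) = RS k \<alpha>"
proof
  have sub: "RS k (\<chi> i. a * \<alpha> $ i + b) \<subseteq> RS k \<alpha>" for a b and \<alpha> :: "'a ^ 'n"
  proof
    fix w assume "w \<in> RS k (\<chi> i. a * \<alpha> $ i + b)"
    then obtain f where f: "degree f < k" "w = (\<chi> i. poly f (a * \<alpha> $ i + b))"
      by (auto simp: RS_def)
    have "degree (pcompose f [:b, a:]) \<le> degree f * degree [:b, a:]"
      by (rule degree_pcompose_le)
    also have "\<dots> \<le> degree f" by simp
    finally have "degree (pcompose f [:b, a:]) < k" using f by simp
    moreover have "w = (\<chi> i. poly (pcompose f [:b, a:]) (\<alpha> $ i))"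
      by (simp add: f poly_pcompose algebra_simps)
    ultimately show "w \<in> RS k \<alpha>" unfolding RS_def by blast
  qed
  show "RS k (\<chi> i. a * \<alpha> $ i + b) \<subseteq> RS k \<alpha>" by (rule sub)
  have "RS k (\<chi> i. inverse a * (\<chi> i. a * \<alpha> $ i + b) $ i + (- inverse a * b))
      \<subseteq> RS k (\<chi> i. a * \<alpha> $ i + b)" by (rule sub)
  also have "(\<chi> i. inverse a * (\<chi> i. a * \<alpha> $ i + b) $ i + (- inverse a * b)) = \<alpha>"
    using assms by (simp add: vec_eq_iff field_simps)
  finally show "RS k \<alpha> \<subseteq> RS k (\<chi> i. a * \<alpha> $ i + b)" .
qed

text \<open>
  The coefficients from position \<open>card A\<close> on determine such a polynomial: the difference of two
  that agree there has degree below \<open>card A\<close> and vanishes on \<open>A\<close>.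
\<close>

lemma card_poly_prescribed:
  fixes A :: "'a::{field,finite} set"
  shows "finite {f :: 'a poly. degree f < k \<and> (\<forall>a\<in>A. poly f a = h a)}" (is "finite ?P")
    and "card {f :: 'a poly. degree f < k \<and> (\<forall>a\<in>A. poly f a = h a)} \<le> CARD('a) ^ (k - card A)"
proof -
  let ?c = "\<lambda>f :: 'a poly. restrict (coeff f) {card A..<k}"
  let ?E = "{card A..<k} \<rightarrow>\<^sub>E (UNIV :: 'a set)"
  have inj: "inj_on ?c ?P"
  proof (rule inj_onI)
    fix f g assume f: "f \<in> ?P" and g: "g \<in> ?P" and eq: "?c f = ?c g"
    have co: "coeff (f - g) i = 0" if "i \<ge> card A" for i
    proof (cases "i < k")
      case True
      then show ?thesis using fun_cong[OF eq, of i] that by simp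
    next
      case False
      then show ?thesis using f g by (simp add: coeff_eq_0)
    qed
    show "f = g"
    proof (rule ccontr)
      assume "f \<noteq> g"
      then have nz: "f - g \<noteq> 0" by simp
      then have "degree (f - g) < card A"
        using co[of "degree (f - g)"] by (meson leading_coeff_0_iff not_le)
      moreover have "card A \<le> card {x. poly (f - g) x = 0}"
        by (rule card_mono) (use f g in auto)
      moreover have "card {x. poly (f - g) x = 0} \<le> degree (f - g)"
        by (rule card_poly_roots_bound[OF nz])
      ultimately show False by simp
    qed
  qed
  have fin: "finite ?E" by (intro finite_PiE) auto
  have im: "?c ` ?P \<subseteq> ?E" by auto
  show "finite ?P" by (rule inj_on_finite[OF inj im fin])
  show "card ?P \<le> CARD('a) ^ (k - card A)"
    using card_inj_on_le[OF inj im fin] by (simp add: card_PiE)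
qed

lemma card_fibres:
  fixes g :: "'a::{field,finite} poly" and w :: "'n::finite \<Rightarrow> 'a"
  assumes "0 < degree g" "degree g < k" "i0 \<noteq> i1"
  shows "card {\<beta> :: 'a ^ 'n. \<beta> $ i0 = x0 \<and> \<beta> $ i1 = x1 \<and> (\<forall>i. poly g (\<beta> $ i) = w i)}
           \<le> (k - 1) ^ (CARD('n) - 2)" (is "card ?S \<le> _")
proof -
  let ?R = "\<lambda>i. if i = i0 then {x0} else if i = i1 then {x1} else {x. poly g x = w i}"
  \<comment> \<open>At the two fixed coordinates the singleton contributes a factor 1, not \<open>k - 1\<close>.\<close>
  have "card ?S \<le> card (PiE UNIV ?R)"
  proof (rule card_inj_on_le)
    show "inj_on (\<lambda>\<beta>. ($) \<beta>) ?S" by (rule inj_onI) (simp add: vec_eq_iff)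
    show "(\<lambda>\<beta>. ($) \<beta>) ` ?S \<subseteq> PiE UNIV ?R" by auto
  qed (intro finite_PiE, auto)
  also have "\<dots> = (\<Prod>i\<in>UNIV. card (?R i))" by (simp add: card_PiE)
  also have "\<dots> = (\<Prod>i\<in>UNIV - {i0, i1}. card (?R i))"
    by (rule prod.mono_neutral_right) auto
  also have "\<dots> \<le> (\<Prod>i\<in>UNIV - {i0, i1}. k - 1)"
  proof (rule prod_mono, intro conjI)
    fix i assume i: "i \<in> UNIV - {i0, i1}"
    have deg: "degree (g - [:w i:]) = degree g"
      using degree_add_eq_left[of "- [:w i:]" g] assms(1)
      by (simp only: diff_conv_add_uminus degree_minus degree_pCons_0)
    then have nz: "g - [:w i:] \<noteq> 0" using assms by auto
    have "?R i = {x. poly (g - [:w i:]) x = 0}" using i by auto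
    then have "card (?R i) \<le> degree g"
      using card_poly_roots_bound[OF nz] deg by simp
    then show "card (?R i) \<le> k - 1" using assms by linarith
  qed simp
  also have "\<dots> = (k - 1) ^ card (UNIV - {i0, i1})" by (rule prod_constant)
  also have "card (UNIV - {i0, i1}) = CARD('n) - card {i0, i1}" by (simp only: card_Diff_subset finite subset_UNIV)
  also have "card {i0, i1} = 2" using assms by simp
  finally show ?thesis .
qed

lemma card_Sigma_le:
  assumes "finite A" "\<And>x. x \<in> A \<Longrightarrow> finite (F x)" "card A \<le> m" "\<And>x. x \<in> A \<Longrightarrow> card (F x) \<le> l"
  shows "card (Sigma A F) \<le> m * l"
proof -
  have "card (Sigma A F) = (\<Sum>x\<in>A. card (F x))" using assms by simp
  also have "\<dots> \<le> card A * l" using sum_bounded_above[of A "\<lambda>x. card (F x)" l] assms by simp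
  also have "\<dots> \<le> m * l" using assms by simp
  finally show ?thesis .
qed

lemma nonconstant_word:
  fixes V :: "('a::field ^ 'n::finite) set"
  assumes "vec.dim V \<ge> 2"
  obtains w i where "w \<in> V" "w $ i \<noteq> w $ j"
proof -
  have "\<exists>w\<in>V. \<exists>i. w $ i \<noteq> w $ j"
  proof (rule ccontr)
    assume "\<not> ?thesis"
    then have const: "w $ i = w $ j" if "w \<in> V" for w i using that by blast
    have "w = (w $ j) *s 1" if "w \<in> V" for w
      unfolding vec_eq_iff vector_smult_component one_index mult_1_right using const[OF that] by blast
    then have "V \<subseteq> vec.span {1}"
      by (metis vec.span_base vec.span_scale singletonI subsetI)
    then have "vec.dim V \<le> card {1 :: 'a ^ 'n}" by (rule vec.dim_le_card) simp
    then show False using assms by simp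
  qed
  then show ?thesis using that by blast
qed

text \<open>
  The affine freedom in \<open>\<beta>\<close> and the constant words common to both codes provide the three
  normalizations.
\<close>

lemma common_word_normalized:
  fixes \<alpha> :: "'a::field ^ 'n::finite"
  assumes D: "D \<in> RS_codes k" and dim: "vec.dim (RS k \<alpha> \<inter> D) \<ge> 2" and ne: "i0 \<noteq> i1"
  obtains \<beta> f g where "D = RS k \<beta>" "\<beta> $ i0 = 0" "\<beta> $ i1 = 1"
    "degree f < k" "degree g < k" "degree g > 0" "poly f (\<alpha> $ i0) = 0"
    "\<forall>i. poly g (\<beta> $ i) = poly f (\<alpha> $ i)"
proof -
  obtain \<gamma> where \<gamma>: "D = RS k \<gamma>" "inj (\<lambda>i. \<gamma> $ i)" using D by (auto simp: RS_codes_def)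
  define u where "u = inverse (\<gamma> $ i1 - \<gamma> $ i0)"
  have d: "\<gamma> $ i1 - \<gamma> $ i0 \<noteq> 0" using \<gamma>(2) ne by (auto simp: inj_def)
  define \<beta> where "\<beta> = (\<chi> i. u * \<gamma> $ i + (- u * \<gamma> $ i0))"
  have \<beta>: "D = RS k \<beta>" unfolding \<beta>_def \<gamma>(1) using d by (intro RS_affine[symmetric]) (simp add: u_def)
  have \<beta>0: "\<beta> $ i0 = 0" by (simp add: \<beta>_def)
  have "\<beta> $ i1 = u * (\<gamma> $ i1 - \<gamma> $ i0)" by (simp add: \<beta>_def algebra_simps)
  then have \<beta>1: "\<beta> $ i1 = 1" using d by (simp add: u_def)
  obtain w j where w: "w \<in> RS k \<alpha> \<inter> D" "w $ j \<noteq> w $ i0" using nonconstant_word[OF dim] .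
  obtain f where f: "degree f < k" "w = (\<chi> i. poly f (\<alpha> $ i))" using w by (auto simp: RS_def)
  obtain g where g: "degree g < k" "w = (\<chi> i. poly g (\<beta> $ i))" using w by (auto simp: RS_def \<beta>)
  let ?f = "f - [:w $ i0:]" and ?g = "g - [:w $ i0:]"
  have wf: "w $ i = poly f (\<alpha> $ i)" for i by (simp add: f(2))
  have wg: "w $ i = poly g (\<beta> $ i)" for i by (simp add: g(2))
  have "degree ?g > 0"
  proof (rule ccontr)
    assume "\<not> ?thesis"
    then obtain c where "?g = [:c:]" by (auto elim: degree_eq_zeroE)
    then have "poly ?g (\<beta> $ j) = poly ?g (\<beta> $ i0)" by simp
    then show False using w(2) by (simp add: wg)
  qed
  moreover have "degree ?f < k" "degree ?g < k"
    using f(1) g(1) by (auto intro: degree_diff_less)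
  moreover have "poly ?f (\<alpha> $ i0) = 0" using wf[of i0] by simp
  moreover have "poly ?g (\<beta> $ i) = poly ?f (\<alpha> $ i)" for i using wf[of i] wg[of i] by simp
  ultimately show ?thesis using that[OF \<beta> \<beta>0 \<beta>1] by blast
qed

theorem claim3p22:
  fixes C :: "('a::{field,finite} ^ 'n::finite) set"
    and q k n :: nat
  assumes "q = CARD('a)" and "n = CARD('n)"
    and "k \<ge> 2" and "2 * k - 1 \<le> n" and "n \<le> q"
    and "C \<in> RS_codes k"
  shows "card {D \<in> RS_codes k. vec.dim (C \<inter> D) \<ge> 2} \<le> B q k n"
proof -
  have n: "n \<ge> 3" and q: "q \<ge> 3" using assms by auto
  obtain i0 i1 :: 'n where ne: "i0 \<noteq> i1"
  proof -
    have "\<not> CARD('n) \<le> Suc 0" using n assms(2) by simp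
    then show ?thesis using that by (auto simp: card_le_Suc0_iff_eq)
  qed
  obtain \<alpha> :: "'a ^ 'n" where \<alpha>: "C = RS k \<alpha>" using assms(6) by (auto simp: RS_codes_def)
  define S where "S = {D \<in> RS_codes k. vec.dim (C \<inter> D) \<ge> 2}"
  define F where "F = {f. degree f < k \<and> (\<forall>a\<in>{\<alpha> $ i0}. poly f a = 0)}"
  define G where "G = (\<lambda>f. {g. degree g < k \<and> (\<forall>a\<in>{0, 1}. poly g a = (if a = 0 then 0 else poly f (\<alpha> $ i1)))}
    \<inter> {g. degree g > 0})"
  define H where "H = (\<lambda>f g. {\<beta> :: 'a ^ 'n. \<beta> $ i0 = 0 \<and> \<beta> $ i1 = 1 \<and> (\<forall>i. poly g (\<beta> $ i) = poly f (\<alpha> $ i))})"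
  define T where "T = Sigma F (\<lambda>f. Sigma (G f) (H f))"

  have finF: "finite F" and cF: "card F \<le> q ^ (k - 1)"
    using card_poly_prescribed[where A = "{\<alpha> $ i0}" and h = "\<lambda>_. 0" and k = k] assms(1)
    by (simp_all add: F_def)
  have finG: "finite (G f)" for f
    unfolding G_def by (intro finite_Int disjI1 card_poly_prescribed)
  have cG: "card (G f) \<le> q ^ (k - 2)" for f
  proof -
    let ?P = "{g. degree g < k \<and> (\<forall>a\<in>{0, 1}. poly g a = (if a = 0 then 0 else poly f (\<alpha> $ i1)))}"
    have "card (G f) \<le> card ?P"
      unfolding G_def by (intro card_mono card_poly_prescribed) simp
    also have "\<dots> \<le> CARD('a) ^ (k - card {0, 1 :: 'a})" by (rule card_poly_prescribed)
    finally show ?thesis using assms(1) by (simp add: numeral_2_eq_2)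
  qed
  have cH: "card (H f g) \<le> (k - 1) ^ (n - 2)" if "g \<in> G f" for f g
    unfolding H_def assms(2) by (rule card_fibres) (use that ne in \<open>auto simp: G_def\<close>)
  have finT: "finite T" unfolding T_def by (intro finite_SigmaI finF finG) simp
  have cT: "card T \<le> q ^ (k - 1) * (q ^ (k - 2) * (k - 1) ^ (n - 2))"
    unfolding T_def by (intro card_Sigma_le finite_SigmaI finF finG cF cG cH) simp_all

  have "\<exists>f g \<beta>. D = RS k \<beta> \<and> (f, g, \<beta>) \<in> T" if "D \<in> S" for D
  proof -
    have D: "D \<in> RS_codes k" "vec.dim (RS k \<alpha> \<inter> D) \<ge> 2" using that by (auto simp: S_def \<alpha>)
    obtain \<beta> f g where *: "D = RS k \<beta>" "\<beta> $ i0 = 0" "\<beta> $ i1 = 1"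
      "degree f < k" "degree g < k" "degree g > 0" "poly f (\<alpha> $ i0) = 0"
      "\<forall>i. poly g (\<beta> $ i) = poly f (\<alpha> $ i)"
      using common_word_normalized[OF D ne] .
    have "poly g 0 = 0" "poly g 1 = poly f (\<alpha> $ i1)"
      using *(8)[rule_format, of i0] *(8)[rule_format, of i1] *(2,3,7) by simp_all
    with * have "(f, g, \<beta>) \<in> T" by (simp add: T_def F_def G_def H_def)
    with *(1) show ?thesis by blast
  qed
  then obtain f g \<beta> where fg\<beta>: "\<And>D. D \<in> S \<Longrightarrow> D = RS k (\<beta> D)" "\<And>D. D \<in> S \<Longrightarrow> (f D, g D, \<beta> D) \<in> T"
    by metis
  \<comment> \<open>Scaling the common word by \<open>c\<close> keeps a triple in \<open>T\<close>. As \<open>g D \<noteq> 0\<close>, the scalar can be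
    read off, so every \<open>D\<close> accounts for \<open>q - 1\<close> triples.\<close>
  let ?h = "\<lambda>(D, c). (smult c (f D), smult c (g D), \<beta> D)"
  have inj: "inj_on ?h (S \<times> (UNIV - {0}))"
  proof (rule inj_onI)
    fix x y assume x: "x \<in> S \<times> (UNIV - {0})" and y: "y \<in> S \<times> (UNIV - {0})" and eq: "?h x = ?h y"
    obtain D c D' c' where xy: "x = (D, c)" "y = (D', c')" by (cases x; cases y)
    have D: "D \<in> S" "D' \<in> S" using x y by (simp_all add: xy)
    have gg: "smult c (g D) = smult c' (g D')" and "\<beta> D = \<beta> D'" using eq by (simp_all add: xy)
    then have DD: "D = D'" using fg\<beta>(1)[OF D(1)] fg\<beta>(1)[OF D(2)] by metis
    have "g D \<noteq> 0" using fg\<beta>(2)[OF D(1)] by (auto simp: T_def G_def)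
    moreover have "smult (c - c') (g D) = 0" using gg DD by (simp add: smult_diff_left)
    ultimately have "c = c'" by simp
    with DD show "x = y" by (simp add: xy)
  qed
  have im: "?h ` (S \<times> (UNIV - {0})) \<subseteq> T"
  proof (rule image_subsetI)
    fix x assume x: "x \<in> S \<times> (UNIV - {0 :: 'a})"
    obtain D c where xy: "x = (D, c)" by (cases x)
    have "D \<in> S" "c \<noteq> 0" using x by (simp_all add: xy)
    then have "(smult c (f D), smult c (g D), \<beta> D) \<in> T"
      using fg\<beta>(2)[of D] by (simp add: T_def F_def G_def H_def)
    then show "?h x \<in> T" by (simp add: xy)
  qed
  have "card S * (q - 1) = card (S \<times> (UNIV - {0 :: 'a}))"
    using assms(1) by (simp add: card_cartesian_product card_Diff_singleton)
  also have "\<dots> \<le> card T" by (rule card_inj_on_le[OF inj im finT])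
  also note cT
  also have "q ^ (k - 1) * (q ^ (k - 2) * (k - 1) ^ (n - 2)) = q * ((k - 1) ^ (n - 2) * q ^ (2 * k - 4))"
  proof -
    have "k - 1 = Suc (k - 2)" "2 * k - 4 = (k - 2) + (k - 2)" using assms(3) by auto
    then have "q ^ (k - 1) = q * q ^ (k - 2)" "q ^ (2 * k - 4) = q ^ (k - 2) * q ^ (k - 2)"
      by (metis power_Suc, metis power_add)
    then show ?thesis by (simp only: mult_ac)
  qed
  also have "\<dots> \<le> (2 * (q - 1)) * ((k - 1) ^ (n - 2) * q ^ (2 * k - 4))"
    using q by (intro mult_right_mono) auto
  also have "\<dots> = B q k n * (q - 1)" by (simp add: B_def mult_ac)
  finally show ?thesis using q by (simp add: S_def)
qed

end
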